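(* Let $\mathcal F=\{\langle\cdot,\cdot\rangle_i\}_{i\in I}$ be a nonpathological and simultaneously orthogonalizable family of inner products on a vector space $V$ over a field $\mathbb{K}$ (with respect to an ultrafilter $\mathfrak U$ on the directed set $I$ containing all the sets $[i,\to)$, $i\in I$), and let $\mathbb{F}=\prod_{i\in I}\mathbb{K}/\mathfrak U$. Then the family $\mathcal F_{\mathbb{F}}\cup\{\langle\!\langle\cdot,\cdot\rangle\!\rangle_{\mathbb{F}}\}$ of inner products on $V_{\mathbb{F}}=V\otimes_{\mathbb{K}}\mathbb{F}$ is nondegenerate.
   Context: An inner product on a vector space $V$ is a symmetric bilinear form with values in the ground field; its radical is $\{x\colon\langle x,V\rangle=0\}$, and it is nondegenerate if its radical is $0$. A family $\{\langle\cdot,\cdot\rangle_i\}_{i\in I}$ of inner products on $V$ is simultaneously orthogonalizable if there is a basis $\{v_j\}$ of $V$ with $\langle v_j,v_k\rangle_i=0$ for all $i\in I$ and all $j\ne k$. For a nondegenerate inner product, the $\langle\cdot,\cdot\rangle$-topology of $V$ is the one in which a basis of neighborhoods of $x\in V$ is given by the sets $x+\bigcap_{k=1}^n v_k^\perp$, with $v_1,\dots,v_n$ a finite collection in $V$ and $v^\perp=\{x\in V\colon\langle x,v\rangle=0\}$. The ground field carries the discrete topology. A map $B\colon X\times X\to Y$ is partially continuous if $B(x,\_)$ and $B(\_,x)$ are continuous for every $x\in X$. A family of inner products is nondegenerate if it contains an element $\langle\cdot,\cdot\rangle_0$ with zero radical such that every element of the family is partially continuous relative to the $\langle\cdot,\cdot\rangle_0$-topology.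 The index set $I$ is assumed to be a directed set for some preorder $\le$ (no loss of generality, e.g. by well-ordering $I$). For $i\in I$, $[i,\to):=\{j\in I\colon i\le j\}$. $\mathfrak U$ is a fixed ultrafilter on $I$ containing the filter $\{S\subset I\colon\exists i\in I,\ [i,\to)\subset S\}$. $\mathbb{F}=\prod_{i\in I}\mathbb{K}_i/\mathfrak U$ with $\mathbb{K}_i=\mathbb{K}$ is the ultrapower: $(x_i)\equiv(y_i)$ iff $\{i\colon x_i=y_i\}\in\mathfrak U$, with class $[(x_i)]$ and componentwise operations; it is an extension field of $\mathbb{K}$ through constant families. An element $x\in V$ is pathological if for every finite-dimensional subspace $S$ of $V$ the set $\{i\in I\colon\langle x,S\rangle_i=0\}$ belongs to $\mathfrak U$; $\mathcal F$ is nonpathological if $0$ is its only pathological element. For an inner product $\langle\cdot,\cdot\rangle$ on $V$, $\langle\cdot,\cdot\rangle_{\mathbb{F}}$ is the inner product on $V_{\mathbb{F}}$ with $\langle v\otimes\lambda,w\otimes\mu\rangle_{\mathbb{F}}=\lambda\mu\langle v,w\rangle$, and $\mathcal F_{\mathbb{F}}=\{\langle\cdot,\cdot\rangle_{\mathbb{F}}\colon\langle\cdot,\cdot\rangle\in\mathcal F\}$. Put $\langle\!\langle x,y\rangle\!\rangle:=[(\langle x,y\rangle_i)_{i\in I}]\in\mathbb{F}$ for $x,y\in V$; $\langle\!\langle\cdot,\cdot\rangle\!\rangle_{\mathbb{F}}$ is the inner product on $V_{\mathbb{F}}$ with $\langle\!\langle x\otimes\lambda,y\otimes\mu\rangle\!\rangle_{\mathbb{F}}:=\lambda\mu\langle\!\langle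 x,y\rangle\!\rangle$. *)

theory Defs
  imports
    "HOL-Algebra.Free_Abelian_Groups"
    "HOL-Analysis.Abstract_Topology"
    "Jordan_Normal_Form.Missing_VectorSpace"
begin

section \<open>Inner products\<close>

locale inner_product = vectorspace K V
  for K :: "('a, 'm) ring_scheme" (structure)
    and V :: "('a, 'v, 'n) module_scheme" (structure) +
  fixes b :: "'v \<Rightarrow> 'v \<Rightarrow> 'a"
  assumes form_closed:
      "\<lbrakk>x \<in> carrier V; y \<in> carrier V\<rbrakk> \<Longrightarrow> b x y \<in> carrier K"
    and form_sym:
      "\<lbrakk>x \<in> carrier V; y \<in> carrier V\<rbrakk> \<Longrightarrow> b x y = b y x"
    and form_add:
      "\<lbrakk>x \<in> carrier V; y \<in> carrier V; z \<in> carrier V\<rbrakk>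
        \<Longrightarrow> b (x \<oplus>\<^bsub>V\<^esub> y) z = b x z \<oplus>\<^bsub>K\<^esub> b y z"
    and form_smult:
      "\<lbrakk>c \<in> carrier K; x \<in> carrier V; y \<in> carrier V\<rbrakk>
        \<Longrightarrow> b (c \<odot>\<^bsub>V\<^esub> x) y = c \<otimes>\<^bsub>K\<^esub> b x y"

definition radical ::
  "('a, 'm) ring_scheme \<Rightarrow> ('a, 'v, 'n) module_scheme \<Rightarrow> ('v \<Rightarrow> 'v \<Rightarrow> 'a) \<Rightarrow> 'v set"
  where "radical K V b = {x \<in> carrier V. \<forall>y\<in>carrier V. b x y = \<zero>\<^bsub>K\<^esub>}"

definition simultaneously_orthogonalizable ::
  "('a, 'm) ring_scheme \<Rightarrow> ('a, 'v, 'n) module_scheme \<Rightarrow> ('i \<Rightarrow> 'v \<Rightarrow> 'v \<Rightarrow> 'a) \<Rightarrow> bool"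
  where "simultaneously_orthogonalizable K V B \<longleftrightarrow>
    (\<exists>A. vectorspace.basis K V A \<and>
         (\<forall>i. \<forall>v\<in>A. \<forall>w\<in>A. v \<noteq> w \<longrightarrow> B i v w = \<zero>\<^bsub>K\<^esub>))"


section \<open>The topology of an inner product and nondegenerate families\<close>

definition orth ::
  "('a, 'm) ring_scheme \<Rightarrow> ('a, 'v, 'n) module_scheme \<Rightarrow> ('v \<Rightarrow> 'v \<Rightarrow> 'a) \<Rightarrow> 'v \<Rightarrow> 'v set"
  where "orth K V b v = {x \<in> carrier V. b x v = \<zero>\<^bsub>K\<^esub>}"

text \<open>Intersecting with \<^term>\<open>carrier V\<close> only matters for the empty family of vectors.\<close>

definition basic_nhd ::
  "('a, 'm) ring_scheme \<Rightarrow> ('a, 'v, 'n) module_scheme \<Rightarrow> ('v \<Rightarrow> 'v \<Rightarrow> 'a) \<Rightarrow> 'v \<Rightarrow> 'v set \<Rightarrow> 'v set"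
  where "basic_nhd K V b x A = (\<lambda>w. x \<oplus>\<^bsub>V\<^esub> w) ` (carrier V \<inter> (\<Inter>v\<in>A. orth K V b v))"

definition form_topology ::
  "('a, 'm) ring_scheme \<Rightarrow> ('a, 'v, 'n) module_scheme \<Rightarrow> ('v \<Rightarrow> 'v \<Rightarrow> 'a) \<Rightarrow> 'v topology"
  where "form_topology K V b = topology (\<lambda>U. U \<subseteq> carrier V \<and>
    (\<forall>x\<in>U. \<exists>A. finite A \<and> A \<subseteq> carrier V \<and> basic_nhd K V b x A \<subseteq> U))"

lemma openin_form_topology:
  "openin (form_topology K V b) U \<longleftrightarrow> U \<subseteq> carrier V \<and>
    (\<forall>x\<in>U. \<exists>A. finite A \<and> A \<subseteq> carrier V \<and> basic_nhd K V b x A \<subseteq> U)"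
proof -
  let ?L = "\<lambda>U. U \<subseteq> carrier V \<and>
    (\<forall>x\<in>U. \<exists>A. finite A \<and> A \<subseteq> carrier V \<and> basic_nhd K V b x A \<subseteq> U)"
  have anti: "basic_nhd K V b x A' \<subseteq> basic_nhd K V b x A" if "A \<subseteq> A'" for x A A'
    using that by (auto simp: basic_nhd_def)
  have "?L (S \<inter> T)" if S: "?L S" and T: "?L T" for S T
  proof (intro conjI ballI)
    show "S \<inter> T \<subseteq> carrier V" using S by blast
    fix x assume x: "x \<in> S \<inter> T"
    obtain A where A: "finite A" "A \<subseteq> carrier V" "basic_nhd K V b x A \<subseteq> S"
      using S x by blast
    obtain A' where A': "finite A'" "A' \<subseteq> carrier V" "basic_nhd K V b x A' \<subseteq> T"
      using T x by blast
    have "basic_nhd K V b x (A \<union> A') \<subseteq> S \<inter> T"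
      using A(3) A'(3) anti[of A "A \<union> A'" x] anti[of A' "A \<union> A'" x] by blast
    then show "\<exists>A. finite A \<and> A \<subseteq> carrier V \<and> basic_nhd K V b x A \<subseteq> S \<inter> T"
      using A A' by (intro exI[of _ "A \<union> A'"]) simp
  qed
  moreover have "?L (\<Union>\<K>)" if "\<forall>S\<in>\<K>. ?L S" for \<K>
    using that by (meson Sup_least UnionE Union_upper subset_trans)
  ultimately have "istopology ?L"
    unfolding istopology_def by blast
  then show ?thesis
    by (simp add: form_topology_def)
qed

definition partially_continuous :: "'x topology \<Rightarrow> 'y topology \<Rightarrow> ('x \<Rightarrow> 'x \<Rightarrow> 'y) \<Rightarrow> bool"
  where "partially_continuous X Y B \<longleftrightarrow>
    (\<forall>x\<in>topspace X. continuous_map X Y (\<lambda>y. B x y) \<and> continuous_map X Y (\<lambda>y. B y x))"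

definition nondegenerate_family ::
  "('a, 'm) ring_scheme \<Rightarrow> ('a, 'v, 'n) module_scheme \<Rightarrow> ('v \<Rightarrow> 'v \<Rightarrow> 'a) set \<Rightarrow> bool"
  where "nondegenerate_family K V \<F> \<longleftrightarrow>
    (\<forall>b\<in>\<F>. inner_product K V b) \<and>
    (\<exists>b0\<in>\<F>. radical K V b0 = {\<zero>\<^bsub>V\<^esub>} \<and>
      (\<forall>b\<in>\<F>. partially_continuous (form_topology K V b0) (discrete_topology (carrier K)) b))"


section \<open>Ultrafilters and ultrapowers\<close>

text \<open>The index set is the whole type \<^typ>\<open>'i\<close>; membership of a set
  \<open>{i. P i}\<close> in the ultrafilter \<open>U\<close> is \<^prop>\<open>eventually P U\<close>.\<close>

definition ultrafilter :: "'i filter \<Rightarrow> bool"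
  where "ultrafilter U \<longleftrightarrow>
    U \<noteq> bot \<and> (\<forall>P. eventually P U \<or> eventually (\<lambda>i. \<not> P i) U)"

definition ultra_class ::
  "('a, 'm) ring_scheme \<Rightarrow> 'i filter \<Rightarrow> ('i \<Rightarrow> 'a) \<Rightarrow> ('i \<Rightarrow> 'a) set"
  where "ultra_class K U x = {y \<in> UNIV \<rightarrow> carrier K. \<forall>\<^sub>F i in U. x i = y i}"

definition ultrapower ::
  "('a, 'm) ring_scheme \<Rightarrow> 'i filter \<Rightarrow> ('i \<Rightarrow> 'a) set ring"
  where "ultrapower K U =
   \<lparr>carrier = ultra_class K U ` (UNIV \<rightarrow> carrier K),
    mult = (\<lambda>X Y. \<Union>x\<in>X. \<Union>y\<in>Y. ultra_class K U (\<lambda>i. x i \<otimes>\<^bsub>K\<^esub> y i)),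
    one = ultra_class K U (\<lambda>i. \<one>\<^bsub>K\<^esub>),
    zero = ultra_class K U (\<lambda>i. \<zero>\<^bsub>K\<^esub>),
    add = (\<lambda>X Y. \<Union>x\<in>X. \<Union>y\<in>Y. ultra_class K U (\<lambda>i. x i \<oplus>\<^bsub>K\<^esub> y i))\<rparr>"

definition ultra_const ::
  "('a, 'm) ring_scheme \<Rightarrow> 'i filter \<Rightarrow> 'a \<Rightarrow> ('i \<Rightarrow> 'a) set"
  where "ultra_const K U c = ultra_class K U (\<lambda>i. c)"


section \<open>Extension of scalars\<close>

text \<open>For a ring homomorphism \<open>h\<close> from \<open>K\<close> to \<open>F\<close>, the tensor product of \<open>V\<close> and \<open>F\<close> over
  \<open>K\<close> is the free abelian group on \<^term>\<open>carrier V \<times> carrier F\<close> modulo the bilinearity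
  relations, with \<open>F\<close> acting on the second tensor factor.\<close>

definition tensor_relations ::
  "('a, 'm) ring_scheme \<Rightarrow> ('a, 'v, 'n) module_scheme \<Rightarrow> ('f, 'k) ring_scheme \<Rightarrow> ('a \<Rightarrow> 'f)
    \<Rightarrow> (('v \<times> 'f) \<Rightarrow>\<^sub>0 int) set"
  where "tensor_relations K V F h =
    {frag_of (v \<oplus>\<^bsub>V\<^esub> w, r) - frag_of (v, r) - frag_of (w, r) | v w r.
       v \<in> carrier V \<and> w \<in> carrier V \<and> r \<in> carrier F} \<union>
    {frag_of (v, r \<oplus>\<^bsub>F\<^esub> s) - frag_of (v, r) - frag_of (v, s) | v r s.
       v \<in> carrier V \<and> r \<in> carrier F \<and> s \<in> carrier F} \<union>
    {frag_of (c \<odot>\<^bsub>V\<^esub> v, r) - frag_of (v, h c \<otimes>\<^bsub>F\<^esub> r) | c v r.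
       c \<in> carrier K \<and> v \<in> carrier V \<and> r \<in> carrier F}"

definition tensor_kernel ::
  "('a, 'm) ring_scheme \<Rightarrow> ('a, 'v, 'n) module_scheme \<Rightarrow> ('f, 'k) ring_scheme \<Rightarrow> ('a \<Rightarrow> 'f)
    \<Rightarrow> (('v \<times> 'f) \<Rightarrow>\<^sub>0 int) set"
  where "tensor_kernel K V F h =
    generate (free_Abelian_group (carrier V \<times> carrier F)) (tensor_relations K V F h)"

definition tensor_class ::
  "('a, 'm) ring_scheme \<Rightarrow> ('a, 'v, 'n) module_scheme \<Rightarrow> ('f, 'k) ring_scheme \<Rightarrow> ('a \<Rightarrow> 'f)
    \<Rightarrow> (('v \<times> 'f) \<Rightarrow>\<^sub>0 int) \<Rightarrow> (('v \<times> 'f) \<Rightarrow>\<^sub>0 int) set"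
  where "tensor_class K V F h t =
    tensor_kernel K V F h #>\<^bsub>free_Abelian_group (carrier V \<times> carrier F)\<^esub> t"

definition tensor ::
  "('a, 'm) ring_scheme \<Rightarrow> ('a, 'v, 'n) module_scheme \<Rightarrow> ('f, 'k) ring_scheme \<Rightarrow> ('a \<Rightarrow> 'f)
    \<Rightarrow> 'v \<Rightarrow> 'f \<Rightarrow> (('v \<times> 'f) \<Rightarrow>\<^sub>0 int) set"
  where "tensor K V F h v r = tensor_class K V F h (frag_of (v, r))"

text \<open>The module record inherits fields for a ring multiplication and unit; they play no role.\<close>

definition scalar_extension ::
  "('a, 'm) ring_scheme \<Rightarrow> ('a, 'v, 'n) module_scheme \<Rightarrow> ('f, 'k) ring_scheme \<Rightarrow> ('a \<Rightarrow> 'f)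
    \<Rightarrow> ('f, (('v \<times> 'f) \<Rightarrow>\<^sub>0 int) set) module"
  where "scalar_extension K V F h =
    (let Q = free_Abelian_group (carrier V \<times> carrier F) Mod tensor_kernel K V F h
     in \<lparr>carrier = carrier Q, mult = undefined, one = undefined,
         zero = \<one>\<^bsub>Q\<^esub>, add = (\<otimes>\<^bsub>Q\<^esub>),
         smult = (\<lambda>s X. \<Union>t\<in>X.
           tensor_class K V F h (frag_extend (\<lambda>(v, r). frag_of (v, s \<otimes>\<^bsub>F\<^esub> r)) t))\<rparr>)"

text \<open>The unique extension of a symmetric \<open>K\<close>-bilinear map with values in \<open>F\<close> to an inner
  product on the scalar extension. Its values on the carrier are determined by the
  condition; those outside of it are arbitrary and play no role.\<close>

definition form_extension ::
  "('a, 'm) ring_scheme \<Rightarrow> ('a, 'v, 'n) module_scheme \<Rightarrow> ('f, 'k) ring_scheme \<Rightarrow> ('a \<Rightarrow> 'f)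
    \<Rightarrow> ('v \<Rightarrow> 'v \<Rightarrow> 'f)
    \<Rightarrow> (('v \<times> 'f) \<Rightarrow>\<^sub>0 int) set \<Rightarrow> (('v \<times> 'f) \<Rightarrow>\<^sub>0 int) set \<Rightarrow> 'f"
  where "form_extension K V F h \<beta> =
    (SOME B. inner_product F (scalar_extension K V F h) B \<and>
      (\<forall>v\<in>carrier V. \<forall>w\<in>carrier V. \<forall>r\<in>carrier F. \<forall>s\<in>carrier F.
        B (tensor K V F h v r) (tensor K V F h w s) = r \<otimes>\<^bsub>F\<^esub> s \<otimes>\<^bsub>F\<^esub> \<beta> v w))"

definition ultra_space ::
  "('a, 'm) ring_scheme \<Rightarrow> ('a, 'v, 'n) module_scheme \<Rightarrow> 'i filter
    \<Rightarrow> (('i \<Rightarrow> 'a) set, (('v \<times> ('i \<Rightarrow> 'a) set) \<Rightarrow>\<^sub>0 int) set) module"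
  where "ultra_space K V U = scalar_extension K V (ultrapower K U) (ultra_const K U)"

definition base_change_form ::
  "('a, 'm) ring_scheme \<Rightarrow> ('a, 'v, 'n) module_scheme \<Rightarrow> 'i filter \<Rightarrow> ('v \<Rightarrow> 'v \<Rightarrow> 'a)
    \<Rightarrow> (('v \<times> ('i \<Rightarrow> 'a) set) \<Rightarrow>\<^sub>0 int) set \<Rightarrow> (('v \<times> ('i \<Rightarrow> 'a) set) \<Rightarrow>\<^sub>0 int) set
    \<Rightarrow> ('i \<Rightarrow> 'a) set"
  where "base_change_form K V U b =
    form_extension K V (ultrapower K U) (ultra_const K U) (\<lambda>v w. ultra_const K U (b v w))"

definition ultra_form ::
  "('a, 'm) ring_scheme \<Rightarrow> 'i filter \<Rightarrow> ('i \<Rightarrow> 'v \<Rightarrow> 'v \<Rightarrow> 'a) \<Rightarrow> 'v \<Rightarrow> 'v \<Rightarrow> ('i \<Rightarrow> 'a) set"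
  where "ultra_form K U B v w = ultra_class K U (\<lambda>i. B i v w)"

definition ultra_form_extension ::
  "('a, 'm) ring_scheme \<Rightarrow> ('a, 'v, 'n) module_scheme \<Rightarrow> 'i filter \<Rightarrow> ('i \<Rightarrow> 'v \<Rightarrow> 'v \<Rightarrow> 'a)
    \<Rightarrow> (('v \<times> ('i \<Rightarrow> 'a) set) \<Rightarrow>\<^sub>0 int) set \<Rightarrow> (('v \<times> ('i \<Rightarrow> 'a) set) \<Rightarrow>\<^sub>0 int) set
    \<Rightarrow> ('i \<Rightarrow> 'a) set"
  where "ultra_form_extension K V U B =
    form_extension K V (ultrapower K U) (ultra_const K U) (ultra_form K U B)"


section \<open>Pathological elements\<close>

definition pathological ::
  "('a, 'm) ring_scheme \<Rightarrow> ('a, 'v, 'n) module_scheme \<Rightarrow> 'i filter \<Rightarrow> ('i \<Rightarrow> 'v \<Rightarrow> 'v \<Rightarrow> 'a)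
    \<Rightarrow> 'v \<Rightarrow> bool"
  where "pathological K V U B x \<longleftrightarrow> x \<in> carrier V \<and>
    (\<forall>S. subspace K S V \<and> vectorspace.fin_dim K (V\<lparr>carrier := S\<rparr>) \<longrightarrow>
      (\<forall>\<^sub>F i in U. \<forall>s\<in>S. B i x s = \<zero>\<^bsub>K\<^esub>))"

definition nonpathological ::
  "('a, 'm) ring_scheme \<Rightarrow> ('a, 'v, 'n) module_scheme \<Rightarrow> 'i filter \<Rightarrow> ('i \<Rightarrow> 'v \<Rightarrow> 'v \<Rightarrow> 'a) \<Rightarrow> bool"
  where "nonpathological K V U B \<longleftrightarrow> {x. pathological K V U B x} = {\<zero>\<^bsub>V\<^esub>}"

end

theory Submission
  imports Defs
begin

text \<open>
  Fix a basis \<open>A\<close> of \<open>V\<close> that is orthogonal for all the given forms. It stays orthogonal for each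
  of their base changes and for the ultraproduct form, so the family on the scalar extension is
  again simultaneously orthogonalizable, along the vectors \<open>a \<otimes> 1\<close> with \<open>a \<in> A\<close>. Such a family
  is nondegenerate as soon as one of its members, \<open>b0\<close>, satisfies \<open>b0 a a \<noteq> 0\<close> for all vectors \<open>a\<close>
  of the orthogonal generating set (lemma \<open>nondegenerate_family_if_orthogonal\<close>): the coordinate
  of \<open>x\<close> at \<open>a\<close> is then \<open>b0 x a / b0 a a\<close>. So a vector orthogonal to all \<open>a\<close> is zero, and if \<open>x\<close>
  is a combination of \<open>a\<^sub>1, \<dots>, a\<^sub>n\<close>, then every \<open>y\<close> in the neighborhood of zero given by
  \<open>b0 y a\<^sub>k = 0\<close> has zero coordinates at \<open>a\<^sub>1, \<dots>, a\<^sub>n\<close>, whence \<open>b y x = 0\<close> for every form \<open>b\<close> of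
  the family.

  Here \<open>b0\<close> is the ultraproduct form. If it vanished at a basis vector \<open>a\<close>, then \<open>B i a a = 0\<close> for
  ultrafilter-many \<open>i\<close>; for each of these \<open>i\<close>, orthogonality makes \<open>a\<close> orthogonal to all of \<open>V\<close>, and
  \<open>a\<close> would be a nonzero pathological element (lemma \<open>ultra_form_diagonal_nonzero\<close>).

  The rest is the construction of the objects involved: the ultrapower is a field, the quotient
  that defines the scalar extension is a vector space over it, generated by the \<open>a \<otimes> 1\<close>, and the
  bilinear forms in question do extend to it (lemma \<open>form_extension_exists\<close>), so that the choice
  in the definition of the extended form picks a form with the intended values.
\<close>

section \<open>Ultrapowers of fields\<close>

lemma ultra_class_eq_iff:
  assumes "x \<in> UNIV \<rightarrow> carrier K" "y \<in> UNIV \<rightarrow> carrier K"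
  shows "ultra_class K U x = ultra_class K U y \<longleftrightarrow> (\<forall>\<^sub>F i in U. x i = y i)"
proof
  assume "ultra_class K U x = ultra_class K U y"
  moreover have "y \<in> ultra_class K U y"
    using assms by (simp add: ultra_class_def)
  ultimately show "\<forall>\<^sub>F i in U. x i = y i"
    by (auto simp: ultra_class_def)
next
  assume xy: "\<forall>\<^sub>F i in U. x i = y i"
  have "(\<forall>\<^sub>F i in U. x i = z i) \<longleftrightarrow> (\<forall>\<^sub>F i in U. y i = z i)" for z
    using xy by (auto elim: eventually_elim2)
  then show "ultra_class K U x = ultra_class K U y"
    by (simp add: ultra_class_def)
qed

lemma ultrapower_carrierE:
  assumes "X \<in> carrier (ultrapower K U)"
  obtains x where "x \<in> UNIV \<rightarrow> carrier K" "X = ultra_class K U x"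
  using assms by (auto simp: ultrapower_def)

lemma ultra_class_closed:
  "x \<in> UNIV \<rightarrow> carrier K \<Longrightarrow> ultra_class K U x \<in> carrier (ultrapower K U)"
  by (simp add: ultrapower_def)

text \<open>The operations of the ultrapower are unions over all representatives. These unions
  collapse to a single class because the class does not depend on the representatives.\<close>

lemma UN_ultra_class:
  assumes x: "x \<in> UNIV \<rightarrow> carrier K" and y: "y \<in> UNIV \<rightarrow> carrier K"
    and f: "\<And>a b. \<lbrakk>a \<in> carrier K; b \<in> carrier K\<rbrakk> \<Longrightarrow> f a b \<in> carrier K"
  shows "(\<Union>x'\<in>ultra_class K U x. \<Union>y'\<in>ultra_class K U y. ultra_class K U (\<lambda>i. f (x' i) (y' i)))
    = ultra_class K U (\<lambda>i. f (x i) (y i))"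
proof -
  have "ultra_class K U (\<lambda>i. f (x' i) (y' i)) = ultra_class K U (\<lambda>i. f (x i) (y i))"
    if "x' \<in> ultra_class K U x" "y' \<in> ultra_class K U y" for x' y'
  proof -
    have x': "x' \<in> UNIV \<rightarrow> carrier K" "\<forall>\<^sub>F i in U. x i = x' i"
      and y': "y' \<in> UNIV \<rightarrow> carrier K" "\<forall>\<^sub>F i in U. y i = y' i"
      using that by (auto simp: ultra_class_def)
    have "\<forall>\<^sub>F i in U. f (x' i) (y' i) = f (x i) (y i)"
      using x'(2) y'(2) by (auto elim: eventually_elim2)
    moreover have "(\<lambda>i. f (x' i) (y' i)) \<in> UNIV \<rightarrow> carrier K"
      "(\<lambda>i. f (x i) (y i)) \<in> UNIV \<rightarrow> carrier K"
      using x'(1) y'(1) x y f by (auto simp: Pi_iff)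
    ultimately show ?thesis
      by (simp add: ultra_class_eq_iff)
  qed
  moreover have "x \<in> ultra_class K U x" "y \<in> ultra_class K U y"
    using x y by (auto simp: ultra_class_def)
  ultimately show ?thesis by blast
qed

context cring
begin

lemma ultrapower_mult:
  assumes "x \<in> UNIV \<rightarrow> carrier R" "y \<in> UNIV \<rightarrow> carrier R"
  shows "ultra_class R U x \<otimes>\<^bsub>ultrapower R U\<^esub> ultra_class R U y = ultra_class R U (\<lambda>i. x i \<otimes> y i)"
  using UN_ultra_class[OF assms, of "(\<otimes>)"] by (simp add: ultrapower_def)

lemma ultrapower_add:
  assumes "x \<in> UNIV \<rightarrow> carrier R" "y \<in> UNIV \<rightarrow> carrier R"
  shows "ultra_class R U x \<oplus>\<^bsub>ultrapower R U\<^esub> ultra_class R U y = ultra_class R U (\<lambda>i. x i \<oplus> y i)"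
  using UN_ultra_class[OF assms, of "(\<oplus>)"] by (simp add: ultrapower_def)

lemma ultrapower_one: "\<one>\<^bsub>ultrapower R U\<^esub> = ultra_class R U (\<lambda>i. \<one>)"
  by (simp add: ultrapower_def)

lemma ultrapower_zero: "\<zero>\<^bsub>ultrapower R U\<^esub> = ultra_class R U (\<lambda>i. \<zero>)"
  by (simp add: ultrapower_def)

lemmas ultrapower_ops = ultrapower_mult ultrapower_add ultrapower_one ultrapower_zero

lemma ultrapower_cring: "cring (ultrapower R U)"
proof (rule cringI)
  note [simp] = ultrapower_ops ultra_class_closed Pi_iff
  show "abelian_group (ultrapower R U)"
  proof (rule abelian_groupI)
    fix X assume "X \<in> carrier (ultrapower R U)"
    then obtain x where x: "x \<in> UNIV \<rightarrow> carrier R" "X = ultra_class R U x"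
      by (rule ultrapower_carrierE)
    then show "\<exists>Y\<in>carrier (ultrapower R U). Y \<oplus>\<^bsub>ultrapower R U\<^esub> X = \<zero>\<^bsub>ultrapower R U\<^esub>"
      by (intro bexI[of _ "ultra_class R U (\<lambda>i. \<ominus> x i)"]) (auto simp: l_neg)
  qed (auto elim!: ultrapower_carrierE simp: a_assoc, auto simp: a_comm)
  show "comm_monoid (ultrapower R U)"
    by (rule comm_monoidI) (auto elim!: ultrapower_carrierE simp: m_assoc, auto simp: m_comm)
qed (auto elim!: ultrapower_carrierE simp: ultrapower_ops ultra_class_closed Pi_iff l_distr)

lemma ultra_const_hom: "ultra_const R U \<in> ring_hom R (ultrapower R U)"
  by (rule ring_hom_memI)
    (auto simp: ultra_const_def ultrapower_ops ultra_class_closed Pi_iff)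

end

text \<open>A sequence whose class is not zero is nonzero on a set of the ultrafilter, because the
  ultrafilter contains that set or its complement; the pointwise inverse there represents an
  inverse.\<close>

lemma (in field) ultrapower_field:
  assumes U: "ultrafilter U"
  shows "field (ultrapower R U)"
proof (rule cring.cring_fieldI2[OF ultrapower_cring])
  have "\<not> (\<forall>\<^sub>F i in U. \<zero> = \<one>)"
    using U by (simp add: ultrafilter_def)
  then show "\<zero>\<^bsub>ultrapower R U\<^esub> \<noteq> \<one>\<^bsub>ultrapower R U\<^esub>"
    unfolding ultrapower_one ultrapower_zero by (subst ultra_class_eq_iff) auto
next
  fix X assume X: "X \<in> carrier (ultrapower R U)" "X \<noteq> \<zero>\<^bsub>ultrapower R U\<^esub>"
  from X(1) obtain x where x: "x \<in> UNIV \<rightarrow> carrier R" "X = ultra_class R U x"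
    by (rule ultrapower_carrierE)
  have "\<not> (\<forall>\<^sub>F i in U. x i = \<zero>)"
    using X(2) x by (simp add: ultrapower_zero ultra_class_eq_iff)
  then have nz: "\<forall>\<^sub>F i in U. x i \<noteq> \<zero>"
    using U unfolding ultrafilter_def by blast
  define y where "y i = (if x i = \<zero> then \<zero> else inv (x i))" for i
  have y: "y \<in> UNIV \<rightarrow> carrier R"
    using x(1) by (auto simp: y_def Pi_iff field_Units)
  have "\<forall>\<^sub>F i in U. x i \<otimes> y i = \<one>"
    using nz by eventually_elim (use x(1) in \<open>auto simp: y_def Pi_iff field_Units\<close>)
  moreover have "(\<lambda>i. x i \<otimes> y i) \<in> UNIV \<rightarrow> carrier R" "(\<lambda>i. \<one>) \<in> UNIV \<rightarrow> carrier R"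
    using x(1) y by auto
  ultimately have "X \<otimes>\<^bsub>ultrapower R U\<^esub> ultra_class R U y = \<one>\<^bsub>ultrapower R U\<^esub>"
    using x y by (simp add: ultrapower_ops ultra_class_eq_iff)
  then show "\<exists>Y\<in>carrier (ultrapower R U). X \<otimes>\<^bsub>ultrapower R U\<^esub> Y = \<one>\<^bsub>ultrapower R U\<^esub>"
    using ultra_class_closed[OF y] by blast
qed

section \<open>Extension of scalars\<close>

locale base_change = V: module K V + F: cring F
  for K :: "('a, 'm) ring_scheme" and V :: "('a, 'v, 'n) module_scheme"
    and F :: "('f, 'k) ring_scheme" +
  fixes h :: "'a \<Rightarrow> 'f"
  assumes h_hom: "h \<in> ring_hom K F"
begin

abbreviation "gens \<equiv> carrier V \<times> carrier F"
abbreviation "N \<equiv> tensor_kernel K V F h"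
abbreviation "E \<equiv> scalar_extension K V F h"
abbreviation "cl \<equiv> tensor_class K V F h"
abbreviation "tens \<equiv> tensor K V F h"

lemma h_closed [simp]: "c \<in> carrier K \<Longrightarrow> h c \<in> carrier F"
  using h_hom by (rule ring_hom_closed)

lemma relations_in_carrier: "tensor_relations K V F h \<subseteq> carrier (free_Abelian_group gens)"
proof -
  have diff: "x - y \<in> carrier (free_Abelian_group gens)"
    if "x \<in> carrier (free_Abelian_group gens)" "y \<in> carrier (free_Abelian_group gens)"
    for x y :: "('v \<times> 'f) \<Rightarrow>\<^sub>0 int"
    using keys_diff[of x y] that by auto
  show ?thesis
    unfolding tensor_relations_def
    by (intro subsetI, elim UnE CollectE exE conjE)
      (simp_all del: carrier_free_Abelian_group_iff add: diff)
qed

lemma kernel_subgroup: "subgroup N (free_Abelian_group gens)"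
  unfolding tensor_kernel_def
  by (intro group.generate_is_subgroup group_free_Abelian_group relations_in_carrier)

lemma kernel_normal: "N \<lhd> free_Abelian_group gens"
  by (intro comm_group.subgroup_imp_normal abelian_free_Abelian_group kernel_subgroup)

lemma relation_in_kernel: "x \<in> tensor_relations K V F h \<Longrightarrow> x \<in> N"
  unfolding tensor_kernel_def by (rule generate.incl)

lemma carrier_E: "carrier E = cl ` carrier (free_Abelian_group gens)"
  by (auto simp: scalar_extension_def Let_def FactGroup_def RCOSETS_def tensor_class_def)

lemma cl_closed: "Poly_Mapping.keys x \<subseteq> gens \<Longrightarrow> cl x \<in> carrier E"
  by (simp add: carrier_E)

lemma cl_add:
  "\<lbrakk>Poly_Mapping.keys x \<subseteq> gens; Poly_Mapping.keys y \<subseteq> gens\<rbrakk> \<Longrightarrow> cl x \<oplus>\<^bsub>E\<^esub> cl y = cl (x + y)"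
  using normal.rcos_sum[OF kernel_normal, of x y]
  by (simp add: scalar_extension_def Let_def FactGroup_def tensor_class_def)

lemma zero_E: "\<zero>\<^bsub>E\<^esub> = N"
  by (simp add: scalar_extension_def Let_def FactGroup_def)

lemma cl_kernel: "x \<in> N \<Longrightarrow> cl x = \<zero>\<^bsub>E\<^esub>"
  unfolding zero_E tensor_class_def
  using subgroup.rcos_const[OF kernel_subgroup group_free_Abelian_group] .

lemma cl_eqI:
  assumes "x - y \<in> N" "Poly_Mapping.keys y \<subseteq> gens"
  shows "cl x = cl y"
proof -
  have "x \<in> N #>\<^bsub>free_Abelian_group gens\<^esub> y"
    using assms(1) unfolding r_coset_def by (auto intro!: bexI[of _ "x - y"])
  then show ?thesis
    unfolding tensor_class_def
    using group.repr_independence[OF group_free_Abelian_group _ _ kernel_subgroup] assms(2)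
    by (metis carrier_free_Abelian_group_iff)
qed

lemma cl_memE:
  assumes "y \<in> cl x"
  obtains n where "n \<in> N" "y = n + x"
  using assms by (auto simp: tensor_class_def r_coset_def)

lemma cl_self: "Poly_Mapping.keys x \<subseteq> gens \<Longrightarrow> x \<in> cl x"
  unfolding tensor_class_def
  by (rule group.rcos_self[OF group_free_Abelian_group _ kernel_subgroup]) simp

lemma E_abelian: "abelian_group E"
proof -
  let ?Q = "free_Abelian_group gens Mod N"
  have Q: "comm_group ?Q"
    by (rule comm_group.abelian_FactGroup[OF abelian_free_Abelian_group kernel_subgroup])
  have eq: "carrier E = carrier ?Q" "\<zero>\<^bsub>E\<^esub> = \<one>\<^bsub>?Q\<^esub>" "\<And>X Y. X \<oplus>\<^bsub>E\<^esub> Y = X \<otimes>\<^bsub>?Q\<^esub> Y"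
    unfolding scalar_extension_def Let_def by simp_all
  note monoid = comm_group.axioms(1)[OF Q] and group = comm_group.axioms(2)[OF Q]
  show ?thesis
  proof (rule abelian_groupI)
    fix X assume "X \<in> carrier E"
    then show "\<exists>Y\<in>carrier E. Y \<oplus>\<^bsub>E\<^esub> X = \<zero>\<^bsub>E\<^esub>"
      unfolding eq by (rule group.l_inv_ex[OF group])
  qed (use comm_monoid.m_comm[OF monoid] group.is_monoid[OF group] in
      \<open>simp_all only: eq monoid.m_closed monoid.m_assoc monoid.one_closed monoid.l_one\<close>)
qed

sublocale E: abelian_group E by (rule E_abelian)

subsection \<open>Tensors\<close>

lemma tensor_closed [simp]: "\<lbrakk>v \<in> carrier V; r \<in> carrier F\<rbrakk> \<Longrightarrow> tens v r \<in> carrier E"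
  unfolding tensor_def by (rule cl_closed) simp

lemma tensor_add_left:
  assumes "v \<in> carrier V" "w \<in> carrier V" "r \<in> carrier F"
  shows "tens (v \<oplus>\<^bsub>V\<^esub> w) r = tens v r \<oplus>\<^bsub>E\<^esub> tens w r"
proof -
  have "frag_of (v \<oplus>\<^bsub>V\<^esub> w, r) - (frag_of (v, r) + frag_of (w, r)) \<in> N"
    using assms by (intro relation_in_kernel) (auto simp: tensor_relations_def diff_diff_eq)
  moreover have "Poly_Mapping.keys (frag_of (v, r) + frag_of (w, r)) \<subseteq> gens"
    using assms keys_add[of "frag_of (v, r)" "frag_of (w, r)"] by auto
  ultimately show ?thesis
    using assms by (simp add: tensor_def cl_add cl_eqI)
qed

lemma tensor_add_right:
  assumes "v \<in> carrier V" "r \<in> carrier F" "s \<in> carrier F"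
  shows "tens v (r \<oplus>\<^bsub>F\<^esub> s) = tens v r \<oplus>\<^bsub>E\<^esub> tens v s"
proof -
  have "frag_of (v, r \<oplus>\<^bsub>F\<^esub> s) - (frag_of (v, r) + frag_of (v, s)) \<in> N"
    using assms by (intro relation_in_kernel) (auto simp: tensor_relations_def diff_diff_eq)
  moreover have "Poly_Mapping.keys (frag_of (v, r) + frag_of (v, s)) \<subseteq> gens"
    using assms keys_add[of "frag_of (v, r)" "frag_of (v, s)"] by auto
  ultimately show ?thesis
    using assms by (simp add: tensor_def cl_add cl_eqI)
qed

lemma tensor_smult_left:
  assumes "c \<in> carrier K" "v \<in> carrier V" "r \<in> carrier F"
  shows "tens (c \<odot>\<^bsub>V\<^esub> v) r = tens v (h c \<otimes>\<^bsub>F\<^esub> r)"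
  unfolding tensor_def
proof (rule cl_eqI)
  show "frag_of (c \<odot>\<^bsub>V\<^esub> v, r) - frag_of (v, h c \<otimes>\<^bsub>F\<^esub> r) \<in> N"
    using assms by (intro relation_in_kernel) (auto simp: tensor_relations_def)
qed (use assms in simp)

lemma tensor_zero_left:
  assumes "r \<in> carrier F" shows "tens \<zero>\<^bsub>V\<^esub> r = \<zero>\<^bsub>E\<^esub>"
  using tensor_add_left[of "\<zero>\<^bsub>V\<^esub>" "\<zero>\<^bsub>V\<^esub>" r] assms by (simp add: E.add.l_cancel_one')

lemma tensor_zero_right:
  assumes "v \<in> carrier V" shows "tens v \<zero>\<^bsub>F\<^esub> = \<zero>\<^bsub>E\<^esub>"
  using tensor_add_right[of v "\<zero>\<^bsub>F\<^esub>" "\<zero>\<^bsub>F\<^esub>"] assms by (simp add: E.add.l_cancel_one')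

lemma cl_uminus_tensor:
  assumes "v \<in> carrier V" "r \<in> carrier F"
  shows "cl (- frag_of (v, r)) = tens v (\<ominus>\<^bsub>F\<^esub> r)"
proof -
  have "cl (- frag_of (v, r)) \<oplus>\<^bsub>E\<^esub> tens v r = tens v (\<ominus>\<^bsub>F\<^esub> r) \<oplus>\<^bsub>E\<^esub> tens v r"
    using assms cl_kernel[of 0] subgroup.one_closed[OF kernel_subgroup]
    by (simp add: tensor_zero_right F.l_neg flip: tensor_add_right) (simp add: tensor_def cl_add)
  moreover have "cl (- frag_of (v, r)) \<in> carrier E"
    using assms by (intro cl_closed) simp
  ultimately show ?thesis
    using assms E.add.right_cancel by simp
qed

text \<open>Negatives of pure tensors are pure tensors, so sums (without differences) of pure tensors
  exhaust the scalar extension.\<close>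

lemma tensor_induct [consumes 1, case_names zero tensor add]:
  assumes X: "X \<in> carrier E"
    and zero: "P \<zero>\<^bsub>E\<^esub>"
    and tensor: "\<And>v r. \<lbrakk>v \<in> carrier V; r \<in> carrier F\<rbrakk> \<Longrightarrow> P (tens v r)"
    and add: "\<And>X Y. \<lbrakk>X \<in> carrier E; Y \<in> carrier E; P X; P Y\<rbrakk> \<Longrightarrow> P (X \<oplus>\<^bsub>E\<^esub> Y)"
  shows "P X"
proof -
  obtain x where x: "Poly_Mapping.keys x \<subseteq> gens" "X = cl x"
    using X by (auto simp: carrier_E)
  have cl0: "cl 0 = \<zero>\<^bsub>E\<^esub>"
    using cl_kernel subgroup.one_closed[OF kernel_subgroup] by simp
  have "P (cl x) \<and> P (cl (- x))"
  proof (rule free_Abelian_group_induct[OF x(1)])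
    fix x y
    assume xy: "Poly_Mapping.keys x \<subseteq> gens" "Poly_Mapping.keys y \<subseteq> gens"
      "P (cl x) \<and> P (cl (- x))" "P (cl y) \<and> P (cl (- y))"
    then have "P (cl x \<oplus>\<^bsub>E\<^esub> cl (- y))" "P (cl y \<oplus>\<^bsub>E\<^esub> cl (- x))"
      by (auto intro!: add cl_closed)
    then show "P (cl (x - y)) \<and> P (cl (- (x - y)))"
      using xy by (simp add: cl_add)
  next
    fix a assume "a \<in> gens"
    then obtain v r where a: "a = (v, r)" "v \<in> carrier V" "r \<in> carrier F"
      by auto
    then show "P (cl (frag_of a)) \<and> P (cl (- frag_of a))"
      using tensor[of v r] tensor[of v "\<ominus>\<^bsub>F\<^esub> r"] cl_uminus_tensor[of v r]
      by (simp add: tensor_def)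
  qed (simp_all add: cl0 zero)
  then show ?thesis using x by simp
qed

text \<open>Uniqueness in the universal property of the tensor product. It reduces the module
  laws and the bilinearity of extended forms to computations with pure tensors.\<close>

lemma additive_eqI:
  assumes H: "abelian_group H" and X: "X \<in> carrier E"
    and f: "\<And>X. X \<in> carrier E \<Longrightarrow> f X \<in> carrier H"
      "\<And>X Y. \<lbrakk>X \<in> carrier E; Y \<in> carrier E\<rbrakk> \<Longrightarrow> f (X \<oplus>\<^bsub>E\<^esub> Y) = f X \<oplus>\<^bsub>H\<^esub> f Y"
    and g: "\<And>X. X \<in> carrier E \<Longrightarrow> g X \<in> carrier H"
      "\<And>X Y. \<lbrakk>X \<in> carrier E; Y \<in> carrier E\<rbrakk> \<Longrightarrow> g (X \<oplus>\<^bsub>E\<^esub> Y) = g X \<oplus>\<^bsub>H\<^esub> g Y"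
    and eq: "\<And>v r. \<lbrakk>v \<in> carrier V; r \<in> carrier F\<rbrakk> \<Longrightarrow> f (tens v r) = g (tens v r)"
  shows "f X = g X"
  using X
proof (induction rule: tensor_induct)
  case zero
  interpret H: abelian_group H by fact
  have "f \<zero>\<^bsub>E\<^esub> = \<zero>\<^bsub>H\<^esub>" "g \<zero>\<^bsub>E\<^esub> = \<zero>\<^bsub>H\<^esub>"
    using f[of "\<zero>\<^bsub>E\<^esub>"] f(2)[of "\<zero>\<^bsub>E\<^esub>" "\<zero>\<^bsub>E\<^esub>"] g[of "\<zero>\<^bsub>E\<^esub>"] g(2)[of "\<zero>\<^bsub>E\<^esub>" "\<zero>\<^bsub>E\<^esub>"]
    by (metis E.l_zero E.zero_closed H.add.l_cancel_one')+
  then show ?case by simp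
qed (simp_all add: f g eq)

text \<open>The universal property of the tensor product: a balanced biadditive map extends to the
  free abelian group on the pairs, and the extension kills the bilinearity relations.\<close>

lemma tensor_universal:
  fixes H :: "('b, 'c) ring_scheme"
  assumes H: "abelian_group H"
    and closed: "\<And>v r. \<lbrakk>v \<in> carrier V; r \<in> carrier F\<rbrakk> \<Longrightarrow> f v r \<in> carrier H"
    and left: "\<And>v w r. \<lbrakk>v \<in> carrier V; w \<in> carrier V; r \<in> carrier F\<rbrakk>
      \<Longrightarrow> f (v \<oplus>\<^bsub>V\<^esub> w) r = f v r \<oplus>\<^bsub>H\<^esub> f w r"
    and right: "\<And>v r s. \<lbrakk>v \<in> carrier V; r \<in> carrier F; s \<in> carrier F\<rbrakk>
      \<Longrightarrow> f v (r \<oplus>\<^bsub>F\<^esub> s) = f v r \<oplus>\<^bsub>H\<^esub> f v s"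
    and scalar: "\<And>c v r. \<lbrakk>c \<in> carrier K; v \<in> carrier V; r \<in> carrier F\<rbrakk>
      \<Longrightarrow> f (c \<odot>\<^bsub>V\<^esub> v) r = f v (h c \<otimes>\<^bsub>F\<^esub> r)"
  obtains g where "\<And>X. X \<in> carrier E \<Longrightarrow> g X \<in> carrier H"
    "\<And>X Y. \<lbrakk>X \<in> carrier E; Y \<in> carrier E\<rbrakk> \<Longrightarrow> g (X \<oplus>\<^bsub>E\<^esub> Y) = g X \<oplus>\<^bsub>H\<^esub> g Y"
    "\<And>v r. \<lbrakk>v \<in> carrier V; r \<in> carrier F\<rbrakk> \<Longrightarrow> g (tens v r) = f v r"
proof -
  interpret H: abelian_group H by fact
  have "case_prod f ` gens \<subseteq> carrier (add_monoid H)"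
    using closed by auto
  note free_universal = comm_group.free_Abelian_group_universal[OF H.a_comm_group this]
  obtain \<phi> where \<phi>: "\<phi> \<in> hom (free_Abelian_group gens) (add_monoid H)"
    "\<And>x. x \<in> gens \<Longrightarrow> \<phi> (frag_of x) = case_prod f x"
    by (rule free_universal) (rule that)
  interpret \<phi>: group_hom "free_Abelian_group gens" "add_monoid H" \<phi>
    using \<phi>(1) by (simp add: group_hom_def group_hom_axioms_def H.a_group)
  have \<phi>_diff: "\<phi> (x - y) = \<phi> x \<ominus>\<^bsub>H\<^esub> \<phi> y"
    if "Poly_Mapping.keys x \<subseteq> gens" "Poly_Mapping.keys y \<subseteq> gens" for x y
    using that \<phi>.hom_mult[of x "- y"] \<phi>.hom_inv[of y]
    by (simp add: a_minus_def a_inv_def)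
  have "\<phi> x = \<zero>\<^bsub>H\<^esub>" if "x \<in> tensor_relations K V F h" for x
  proof -
    have minus: "a \<oplus>\<^bsub>H\<^esub> b \<ominus>\<^bsub>H\<^esub> a \<ominus>\<^bsub>H\<^esub> b = \<zero>\<^bsub>H\<^esub>" if "a \<in> carrier H" "b \<in> carrier H" for a b
    proof -
      have "a \<oplus>\<^bsub>H\<^esub> b \<ominus>\<^bsub>H\<^esub> a \<ominus>\<^bsub>H\<^esub> b = (a \<oplus>\<^bsub>H\<^esub> b) \<oplus>\<^bsub>H\<^esub> \<ominus>\<^bsub>H\<^esub> (a \<oplus>\<^bsub>H\<^esub> b)"
        using that by (simp add: a_minus_def H.minus_add H.a_assoc)
      then show ?thesis
        using that by (simp add: H.r_neg)
    qed
    have self: "a \<ominus>\<^bsub>H\<^esub> a = \<zero>\<^bsub>H\<^esub>" if "a \<in> carrier H" for a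
      using that by (simp add: a_minus_def H.r_neg)
    have dk: "Poly_Mapping.keys (frag_of a - frag_of b) \<subseteq> gens" if "a \<in> gens" "b \<in> gens" for a b
      using keys_diff[of "frag_of a" "frag_of b"] that by auto
    show ?thesis
      using that unfolding tensor_relations_def
    proof (elim UnE CollectE exE conjE)
      fix v w r
      assume "x = frag_of (v \<oplus>\<^bsub>V\<^esub> w, r) - frag_of (v, r) - frag_of (w, r)"
        and "v \<in> carrier V" "w \<in> carrier V" "r \<in> carrier F"
      then show ?thesis
        by (simp add: \<phi>_diff dk \<phi>(2) left minus closed)
    next
      fix v r s
      assume "x = frag_of (v, r \<oplus>\<^bsub>F\<^esub> s) - frag_of (v, r) - frag_of (v, s)"
        and "v \<in> carrier V" "r \<in> carrier F" "s \<in> carrier F"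
      then show ?thesis
        by (simp add: \<phi>_diff dk \<phi>(2) right minus closed)
    next
      fix c v r
      assume "x = frag_of (c \<odot>\<^bsub>V\<^esub> v, r) - frag_of (v, h c \<otimes>\<^bsub>F\<^esub> r)"
        and "c \<in> carrier K" "v \<in> carrier V" "r \<in> carrier F"
      then show ?thesis
        by (simp add: \<phi>_diff \<phi>(2) scalar self closed)
    qed
  qed
  then have "tensor_relations K V F h \<subseteq> kernel (free_Abelian_group gens) (add_monoid H) \<phi>"
    using relations_in_carrier
    by (auto simp: kernel_def simp del: carrier_free_Abelian_group_iff)
  then have "N \<subseteq> kernel (free_Abelian_group gens) (add_monoid H) \<phi>"
    unfolding tensor_kernel_def
    by (intro group.generate_subgroup_incl \<phi>.subgroup_kernel group_free_Abelian_group)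
  then obtain g where g: "g \<in> hom (free_Abelian_group gens Mod N) (add_monoid H)"
    "\<And>x. x \<in> carrier (free_Abelian_group gens) \<Longrightarrow> g (N #>\<^bsub>free_Abelian_group gens\<^esub> x) = \<phi> x"
    using \<phi>.FactGroup_universal_kernel[OF kernel_normal] by metis
  have gE: "g (cl x) = \<phi> x" if "Poly_Mapping.keys x \<subseteq> gens" for x
    using g(2) that by (simp add: tensor_class_def)
  show thesis
  proof
    fix X Y assume "X \<in> carrier E" "Y \<in> carrier E"
    then obtain x y where "Poly_Mapping.keys x \<subseteq> gens" "X = cl x"
      "Poly_Mapping.keys y \<subseteq> gens" "Y = cl y"
      by (auto simp: carrier_E)
    moreover from this have "Poly_Mapping.keys (x + y) \<subseteq> gens"
      using keys_add[of x y] by blast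
    ultimately show "g (X \<oplus>\<^bsub>E\<^esub> Y) = g X \<oplus>\<^bsub>H\<^esub> g Y"
      using \<phi>.hom_mult[of x y] by (simp add: cl_add gE)
  next
    fix X assume "X \<in> carrier E"
    then show "g X \<in> carrier H"
      using \<phi>.hom_closed by (auto simp: carrier_E gE)
  next
    fix v r assume "v \<in> carrier V" "r \<in> carrier F"
    then show "g (tens v r) = f v r"
      by (simp add: tensor_def gE \<phi>(2))
  qed
qed

subsection \<open>Scalar multiplication\<close>

abbreviation "scale s \<equiv> frag_extend (\<lambda>(v, r). frag_of (v, s \<otimes>\<^bsub>F\<^esub> r))"

lemma scale_keys:
  assumes "s \<in> carrier F" "Poly_Mapping.keys x \<subseteq> gens"
  shows "Poly_Mapping.keys (scale s x) \<subseteq> gens"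
  using keys_frag_extend[of "\<lambda>(v, r). frag_of (v, s \<otimes>\<^bsub>F\<^esub> r)" x] assms by fastforce

text \<open>Multiplying all second factors by \<open>s\<close> carries each of the three kinds of relations to a
  relation of the same kind, by distributivity and commutativity of \<open>F\<close>. Hence it acts on the
  quotient, and this action is the scalar multiplication.\<close>

lemma scale_relation:
  assumes s: "s \<in> carrier F" and x: "x \<in> tensor_relations K V F h"
  shows "scale s x \<in> tensor_relations K V F h"
  using x unfolding tensor_relations_def
proof (elim UnE CollectE exE conjE, goal_cases)
  case (1 v w r)
  then show ?case
    using s by (intro UnI1 CollectI exI[of _ v] exI[of _ w] exI[of _ "s \<otimes>\<^bsub>F\<^esub> r"])
      (simp add: frag_extend_diff)
next
  case (2 v r t)
  then show ?case
    using s by (intro UnI1 UnI2 CollectI exI[of _ v] exI[of _ "s \<otimes>\<^bsub>F\<^esub> r"] exI[of _ "s \<otimes>\<^bsub>F\<^esub> t"])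
      (simp add: frag_extend_diff F.r_distr)
next
  case (3 c v r)
  then show ?case
    using s by (intro UnI2 CollectI exI[of _ c] exI[of _ v] exI[of _ "s \<otimes>\<^bsub>F\<^esub> r"])
      (simp add: frag_extend_diff F.m_lcomm)
qed

lemma scale_kernel:
  assumes s: "s \<in> carrier F" and x: "x \<in> N"
  shows "scale s x \<in> N"
  using x unfolding tensor_kernel_def
proof (induction rule: generate.induct)
  case one
  then show ?case
    using generate.one[of "free_Abelian_group gens"] by simp
next
  case (incl x)
  then show ?case
    by (intro generate.incl scale_relation s)
next
  case (inv x)
  then have "x \<in> carrier (free_Abelian_group gens)"
    using relations_in_carrier by blast
  moreover have "inv\<^bsub>free_Abelian_group gens\<^esub> (scale s x) \<in> N"
    unfolding tensor_kernel_def by (intro generate.inv scale_relation s inv)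
  ultimately show ?case
    using scale_keys[OF s, of x] by (simp add: frag_extend_minus tensor_kernel_def)
next
  case (eng x y)
  then show ?case
    using generate.eng[OF eng.IH] by (simp add: frag_extend_add)
qed

lemma smult_cl:
  assumes s: "s \<in> carrier F" and x: "Poly_Mapping.keys x \<subseteq> gens"
  shows "s \<odot>\<^bsub>E\<^esub> cl x = cl (scale s x)"
proof -
  have "cl (scale s t) = cl (scale s x)" if t: "t \<in> cl x" for t
  proof (rule cl_eqI)
    obtain n where "n \<in> N" "t = n + x"
      using t by (rule cl_memE)
    then show "scale s t - scale s x \<in> N"
      using scale_kernel[OF s] by (simp add: frag_extend_add)
  qed (use s x scale_keys in blast)
  moreover have "s \<odot>\<^bsub>E\<^esub> cl x = (\<Union>t\<in>cl x. cl (scale s t))"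
    by (simp add: scalar_extension_def Let_def)
  ultimately show ?thesis
    using cl_self[OF x] by blast
qed

lemma smult_tensor:
  "\<lbrakk>s \<in> carrier F; v \<in> carrier V; r \<in> carrier F\<rbrakk> \<Longrightarrow> s \<odot>\<^bsub>E\<^esub> tens v r = tens v (s \<otimes>\<^bsub>F\<^esub> r)"
  by (simp add: tensor_def smult_cl)

lemma smult_E_closed: "\<lbrakk>s \<in> carrier F; X \<in> carrier E\<rbrakk> \<Longrightarrow> s \<odot>\<^bsub>E\<^esub> X \<in> carrier E"
  by (auto simp: carrier_E smult_cl scale_keys)

lemma smult_E_add:
  assumes "s \<in> carrier F" "X \<in> carrier E" "Y \<in> carrier E"
  shows "s \<odot>\<^bsub>E\<^esub> (X \<oplus>\<^bsub>E\<^esub> Y) = s \<odot>\<^bsub>E\<^esub> X \<oplus>\<^bsub>E\<^esub> s \<odot>\<^bsub>E\<^esub> Y"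
proof -
  obtain x y where xy: "Poly_Mapping.keys x \<subseteq> gens" "X = cl x"
    "Poly_Mapping.keys y \<subseteq> gens" "Y = cl y"
    using assms by (auto simp: carrier_E)
  then have "Poly_Mapping.keys (x + y) \<subseteq> gens"
    using keys_add[of x y] by blast
  then show ?thesis
    using xy assms(1) by (simp add: cl_add smult_cl scale_keys frag_extend_add)
qed

lemma E_module: "module F E"
proof (rule moduleI)
  note [simp] = smult_tensor smult_E_closed smult_E_add
  fix r s X assume r: "r \<in> carrier F" and s: "s \<in> carrier F" and X: "X \<in> carrier E"
  show "(r \<oplus>\<^bsub>F\<^esub> s) \<odot>\<^bsub>E\<^esub> X = r \<odot>\<^bsub>E\<^esub> X \<oplus>\<^bsub>E\<^esub> s \<odot>\<^bsub>E\<^esub> X"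
    by (rule additive_eqI[OF E_abelian X])
      (use r s in \<open>simp_all add: F.l_distr tensor_add_right E.add.m_ac\<close>)
  show "(r \<otimes>\<^bsub>F\<^esub> s) \<odot>\<^bsub>E\<^esub> X = r \<odot>\<^bsub>E\<^esub> (s \<odot>\<^bsub>E\<^esub> X)"
    by (rule additive_eqI[OF E_abelian X]) (use r s in \<open>simp_all add: F.m_assoc\<close>)
next
  fix X assume X: "X \<in> carrier E"
  show "\<one>\<^bsub>F\<^esub> \<odot>\<^bsub>E\<^esub> X = X"
    by (rule additive_eqI[OF E_abelian X]) (simp_all add: smult_tensor smult_E_closed smult_E_add)
qed (simp_all add: F.is_cring E_abelian smult_E_closed smult_E_add)

subsection \<open>Extending bilinear forms\<close>

text \<open>The universal property is applied once per variable. For fixed \<open>w\<close> and \<open>s\<close>, it gives the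
  functional \<open>\<phi> w s\<close> that pairs with the pure tensor of \<open>w\<close> and \<open>s\<close>; for fixed \<open>X\<close>, the value
  \<open>\<phi> w s X\<close> is biadditive and balanced in \<open>w\<close> and \<open>s\<close>, so it extends to an additive map \<open>B X\<close>.
  Symmetry and linearity of \<open>B\<close> then follow from their validity on pure tensors.\<close>

lemma form_extension_exists:
  assumes field: "field F"
    and \<beta>_closed: "\<And>v w. \<lbrakk>v \<in> carrier V; w \<in> carrier V\<rbrakk> \<Longrightarrow> \<beta> v w \<in> carrier F"
    and \<beta>_sym: "\<And>v w. \<lbrakk>v \<in> carrier V; w \<in> carrier V\<rbrakk> \<Longrightarrow> \<beta> v w = \<beta> w v"
    and \<beta>_add: "\<And>v w u. \<lbrakk>v \<in> carrier V; w \<in> carrier V; u \<in> carrier V\<rbrakk>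
      \<Longrightarrow> \<beta> (v \<oplus>\<^bsub>V\<^esub> w) u = \<beta> v u \<oplus>\<^bsub>F\<^esub> \<beta> w u"
    and \<beta>_smult: "\<And>c v w. \<lbrakk>c \<in> carrier K; v \<in> carrier V; w \<in> carrier V\<rbrakk>
      \<Longrightarrow> \<beta> (c \<odot>\<^bsub>V\<^esub> v) w = h c \<otimes>\<^bsub>F\<^esub> \<beta> v w"
  shows "\<exists>B. inner_product F E B \<and>
    (\<forall>v\<in>carrier V. \<forall>w\<in>carrier V. \<forall>r\<in>carrier F. \<forall>s\<in>carrier F.
      B (tens v r) (tens w s) = r \<otimes>\<^bsub>F\<^esub> s \<otimes>\<^bsub>F\<^esub> \<beta> v w)"
proof -
  interpret E: module F E by (rule E_module)
  define additive where "additive f \<longleftrightarrow> (\<forall>X\<in>carrier E. f X \<in> carrier F) \<and>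
    (\<forall>X\<in>carrier E. \<forall>Y\<in>carrier E. f (X \<oplus>\<^bsub>E\<^esub> Y) = f X \<oplus>\<^bsub>F\<^esub> f Y)" for f
  have ext: "f X = g X"
    if "additive f" "additive g" "X \<in> carrier E"
      "\<And>v r. \<lbrakk>v \<in> carrier V; r \<in> carrier F\<rbrakk> \<Longrightarrow> f (tens v r) = g (tens v r)" for f g X
    using that unfolding additive_def
    by (intro additive_eqI[OF F.abelian_group_axioms, of X f g]) auto
  have additive_sum: "additive (\<lambda>X. f X \<oplus>\<^bsub>F\<^esub> g X)" if "additive f" "additive g" for f g
    using that by (simp add: additive_def F.add.m_ac)
  have additive_mult: "additive (\<lambda>X. c \<otimes>\<^bsub>F\<^esub> f X)" if "additive f" "c \<in> carrier F" for f c
    using that by (simp add: additive_def F.r_distr)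
  note [simp] = \<beta>_closed \<beta>_add \<beta>_smult smult_tensor

  have universal: "\<exists>g. additive g \<and> (\<forall>v\<in>carrier V. \<forall>r\<in>carrier F. g (tens v r) = f v r)"
    if "\<And>v r. \<lbrakk>v \<in> carrier V; r \<in> carrier F\<rbrakk> \<Longrightarrow> f v r \<in> carrier F"
      "\<And>v w r. \<lbrakk>v \<in> carrier V; w \<in> carrier V; r \<in> carrier F\<rbrakk>
        \<Longrightarrow> f (v \<oplus>\<^bsub>V\<^esub> w) r = f v r \<oplus>\<^bsub>F\<^esub> f w r"
      "\<And>v r s. \<lbrakk>v \<in> carrier V; r \<in> carrier F; s \<in> carrier F\<rbrakk>
        \<Longrightarrow> f v (r \<oplus>\<^bsub>F\<^esub> s) = f v r \<oplus>\<^bsub>F\<^esub> f v s"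
      "\<And>c v r. \<lbrakk>c \<in> carrier K; v \<in> carrier V; r \<in> carrier F\<rbrakk>
        \<Longrightarrow> f (c \<odot>\<^bsub>V\<^esub> v) r = f v (h c \<otimes>\<^bsub>F\<^esub> r)"
    for f
    by (rule tensor_universal[OF F.abelian_group_axioms that], assumption+)
      (unfold additive_def, blast)
  have "\<exists>g. additive g \<and> (\<forall>v\<in>carrier V. \<forall>r\<in>carrier F. g (tens v r) = r \<otimes>\<^bsub>F\<^esub> s \<otimes>\<^bsub>F\<^esub> \<beta> v w)"
    if "w \<in> carrier V" "s \<in> carrier F" for w s
    by (rule universal) (use that in \<open>simp_all add: F.r_distr F.l_distr F.m_ac\<close>)
  then obtain \<phi> where \<phi>: "\<And>w s. \<lbrakk>w \<in> carrier V; s \<in> carrier F\<rbrakk> \<Longrightarrow> additive (\<phi> w s)"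
    "\<And>v r w s. \<lbrakk>v \<in> carrier V; r \<in> carrier F; w \<in> carrier V; s \<in> carrier F\<rbrakk>
      \<Longrightarrow> \<phi> w s (tens v r) = r \<otimes>\<^bsub>F\<^esub> s \<otimes>\<^bsub>F\<^esub> \<beta> v w"
    by metis
  have \<beta>_add': "\<beta> u (v \<oplus>\<^bsub>V\<^esub> w) = \<beta> u v \<oplus>\<^bsub>F\<^esub> \<beta> u w"
    and \<beta>_smult': "c \<in> carrier K \<Longrightarrow> \<beta> u (c \<odot>\<^bsub>V\<^esub> v) = h c \<otimes>\<^bsub>F\<^esub> \<beta> u v"
    if "u \<in> carrier V" "v \<in> carrier V" "w \<in> carrier V" for c u v w
    using that \<beta>_sym[of u] by simp_all
  have "\<exists>g. additive g \<and> (\<forall>w\<in>carrier V. \<forall>s\<in>carrier F. g (tens w s) = \<phi> w s X)"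
    if X: "X \<in> carrier E" for X
  proof (rule universal)
    show "\<phi> w s X \<in> carrier F" if "w \<in> carrier V" "s \<in> carrier F" for w s
      using \<phi>(1)[OF that] X by (simp add: additive_def)
    show "\<phi> (v \<oplus>\<^bsub>V\<^esub> w) s X = \<phi> v s X \<oplus>\<^bsub>F\<^esub> \<phi> w s X"
      if "v \<in> carrier V" "w \<in> carrier V" "s \<in> carrier F" for v w s
      by (rule ext) (use that X in \<open>simp_all add: \<phi> additive_sum \<beta>_add' F.r_distr\<close>)
    show "\<phi> w (r \<oplus>\<^bsub>F\<^esub> s) X = \<phi> w r X \<oplus>\<^bsub>F\<^esub> \<phi> w s X"
      if "w \<in> carrier V" "r \<in> carrier F" "s \<in> carrier F" for w r s
      by (rule ext) (use that X in \<open>simp_all add: \<phi> additive_sum F.r_distr F.l_distr\<close>)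
    show "\<phi> (c \<odot>\<^bsub>V\<^esub> w) s X = \<phi> w (h c \<otimes>\<^bsub>F\<^esub> s) X"
      if "c \<in> carrier K" "w \<in> carrier V" "s \<in> carrier F" for c w s
      by (rule ext) (use that X in \<open>simp_all add: \<phi> \<beta>_smult' F.m_ac\<close>)
  qed
  then obtain B where B: "\<And>X. X \<in> carrier E \<Longrightarrow> additive (B X)"
    "\<And>X w s. \<lbrakk>X \<in> carrier E; w \<in> carrier V; s \<in> carrier F\<rbrakk> \<Longrightarrow> B X (tens w s) = \<phi> w s X"
    by metis
  have BT: "B (tens v r) (tens w s) = r \<otimes>\<^bsub>F\<^esub> s \<otimes>\<^bsub>F\<^esub> \<beta> v w"
    if "v \<in> carrier V" "w \<in> carrier V" "r \<in> carrier F" "s \<in> carrier F" for v w r s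
    using that by (simp add: B \<phi>)
  have closed: "B X Y \<in> carrier F" if "X \<in> carrier E" "Y \<in> carrier E" for X Y
    using B(1) that by (simp add: additive_def)
  have add: "B (X \<oplus>\<^bsub>E\<^esub> Y) Z = B X Z \<oplus>\<^bsub>F\<^esub> B Y Z"
    if "X \<in> carrier E" "Y \<in> carrier E" "Z \<in> carrier E" for X Y Z
    by (rule ext) (use that \<phi>(1) in \<open>simp_all add: B additive_sum, simp add: additive_def\<close>)
  \<comment> \<open>By construction, \<open>B\<close> is additive in its second argument; \<open>add\<close> allows for reducing to pure
    tensors in the first one as well.\<close>
  have flip: "additive (\<lambda>X. B X Y)" if "Y \<in> carrier E" for Y
    using that by (simp add: additive_def closed add)
  have smult: "B (c \<odot>\<^bsub>E\<^esub> X) Y = c \<otimes>\<^bsub>F\<^esub> B X Y"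
    if "c \<in> carrier F" "X \<in> carrier E" "Y \<in> carrier E" for c X Y
  proof (rule ext[of "B (c \<odot>\<^bsub>E\<^esub> X)" "\<lambda>Y. c \<otimes>\<^bsub>F\<^esub> B X Y"])
    fix w s assume w: "w \<in> carrier V" "s \<in> carrier F"
    have "additive (\<lambda>X. B (c \<odot>\<^bsub>E\<^esub> X) (tens w s))"
      using that w by (simp add: additive_def closed add E.smult_r_distr)
    from ext[OF this additive_mult[OF flip] that(2)]
    show "B (c \<odot>\<^bsub>E\<^esub> X) (tens w s) = c \<otimes>\<^bsub>F\<^esub> B X (tens w s)"
      using that w by (simp add: BT F.m_assoc)
  qed (use that in \<open>simp_all add: B additive_mult\<close>)
  have sym: "B X Y = B Y X" if "X \<in> carrier E" "Y \<in> carrier E" for X Y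
  proof (rule ext[of "B X" "\<lambda>Y. B Y X"])
    fix w s assume w: "w \<in> carrier V" "s \<in> carrier F"
    show "B X (tens w s) = B (tens w s) X"
      by (rule ext[of "\<lambda>X. B X (tens w s)" "B (tens w s)"])
        (use that w in \<open>simp_all add: B flip, simp add: \<phi> \<beta>_sym F.m_comm\<close>)
  qed (use that in \<open>simp_all add: B flip\<close>)
  have "vectorspace F E"
    using E_module field by (simp add: vectorspace_def)
  then have "inner_product F E B"
    by (simp add: inner_product_def inner_product_axioms_def closed add smult) (metis sym)
  with BT show ?thesis by blast
qed

lemmas form_extension_spec = form_extension_exists[THEN someI_ex, folded form_extension_def]

text \<open>The vectors \<open>v\<close> whose tensor with \<open>1\<close> lies in the span form a submodule of \<open>V\<close>, which contains
  \<open>A\<close> and hence everything; and a general pure tensor is a scalar multiple of such a tensor.\<close>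

lemma span_tensor_one:
  assumes A: "A \<subseteq> carrier V" and span: "module.span K V A = carrier V"
  shows "module.span F E ((\<lambda>a. tens a \<one>\<^bsub>F\<^esub>) ` A) = carrier E"
proof -
  interpret E: module F E by (rule E_module)
  let ?T = "(\<lambda>a. tens a \<one>\<^bsub>F\<^esub>) ` A"
  have T: "?T \<subseteq> carrier E"
    using A by auto
  interpret S: submodule F "E.span ?T" E
    using T by (rule E.span_is_submodule)
  have smult_one: "r \<odot>\<^bsub>E\<^esub> tens v \<one>\<^bsub>F\<^esub> = tens v r" if "v \<in> carrier V" "r \<in> carrier F" for v r
    using that by (simp add: smult_tensor)
  let ?W = "{v \<in> carrier V. tens v \<one>\<^bsub>F\<^esub> \<in> E.span ?T}"
  have "submodule K ?W V"
  proof
    fix c v assume c: "c \<in> carrier K" and v: "v \<in> ?W"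
    then have "tens (c \<odot>\<^bsub>V\<^esub> v) \<one>\<^bsub>F\<^esub> = h c \<odot>\<^bsub>E\<^esub> tens v \<one>\<^bsub>F\<^esub>"
      by (simp add: tensor_smult_left smult_tensor)
    then show "c \<odot>\<^bsub>V\<^esub> v \<in> ?W"
      using c v by auto
  qed (auto simp: tensor_add_left tensor_zero_left V.module_axioms)
  moreover have "A \<subseteq> ?W"
    using A E.in_own_span[OF T] by auto
  ultimately have "V.span A \<subseteq> ?W"
    by (intro V.span_is_subset)
  then have W: "carrier V \<subseteq> ?W"
    by (simp only: span)
  have "X \<in> E.span ?T" if "X \<in> carrier E" for X
    using that
  proof (induction rule: tensor_induct)
    case (tensor v r)
    then have "r \<odot>\<^bsub>E\<^esub> tens v \<one>\<^bsub>F\<^esub> \<in> E.span ?T"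
      using W by auto
    then show ?case using tensor by (simp add: smult_one)
  qed auto
  then show ?thesis
    using E.span_is_subset2[OF T] by blast
qed

end

section \<open>Families with a common orthogonal generating set\<close>

context inner_product
begin

lemma form_zero: "y \<in> carrier V \<Longrightarrow> b \<zero>\<^bsub>V\<^esub> y = \<zero>"
  using form_smult[of "\<zero>" "\<zero>\<^bsub>V\<^esub>" y] form_closed[of "\<zero>\<^bsub>V\<^esub>" y] by simp

lemma form_lincomb:
  assumes "finite S" "S \<subseteq> carrier V" "c \<in> S \<rightarrow> carrier K" "y \<in> carrier V"
  shows "b (lincomb c S) y = (\<Oplus>s\<in>S. c s \<otimes> b s y)"
  using assms
proof (induction S rule: finite_induct)
  case empty
  then show ?case by (simp add: lincomb_def form_zero)
next
  case (insert s S)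
  have c: "c \<in> S \<rightarrow> carrier K" "c s \<in> carrier K" "S \<subseteq> carrier V" "s \<in> carrier V"
    using insert.prems by auto
  have "lincomb c (insert s S) = c s \<odot>\<^bsub>V\<^esub> s \<oplus>\<^bsub>V\<^esub> lincomb c S"
    unfolding lincomb_def
    by (rule M.finsum_insert) (use insert.hyps c in \<open>auto simp: Pi_iff\<close>)
  moreover have "(\<Oplus>t\<in>insert s S. c t \<otimes> b t y) = c s \<otimes> b s y \<oplus> (\<Oplus>t\<in>S. c t \<otimes> b t y)"
    by (rule R.finsum_insert) (use insert.hyps insert.prems c in \<open>auto simp: Pi_iff intro!: form_closed\<close>)
  moreover have "lincomb c S \<in> carrier V"
    using c insert.hyps by auto
  ultimately show ?case
    using insert.IH insert.prems c by (simp add: form_add form_smult)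
qed

text \<open>Pairing with a member of an orthogonal set reads off one coordinate, up to the factor
  \<open>b a a\<close>.\<close>

lemma form_lincomb_orthogonal:
  assumes orth: "\<And>v w. \<lbrakk>v \<in> A; w \<in> A; v \<noteq> w\<rbrakk> \<Longrightarrow> b v w = \<zero>"
    and A: "A \<subseteq> carrier V" and S: "finite S" "S \<subseteq> A" "c \<in> S \<rightarrow> carrier K" and a: "a \<in> A"
  shows "b (lincomb c S) a = (if a \<in> S then c a \<otimes> b a a else \<zero>)"
proof -
  have closed: "c s \<otimes> b s a \<in> carrier K" if "s \<in> S" for s
    by (intro R.m_closed form_closed) (use that S A a in blast)+
  have off_diagonal: "c s \<otimes> b s a = \<zero>" if "s \<in> S" "s \<noteq> a" for s
  proof -
    have "c s \<in> carrier K" "s \<in> A" using that S by blast+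
    then show ?thesis using orth[of s a] that(2) a by simp
  qed
  have "b (lincomb c S) a = (\<Oplus>s\<in>S. c s \<otimes> b s a)"
    by (rule form_lincomb) (use S A a in blast)+
  also have "\<dots> = (\<Oplus>s\<in>S. if a = s then c s \<otimes> b s a else \<zero>)"
  proof (rule R.finsum_cong')
    show "c s \<otimes> b s a = (if a = s then c s \<otimes> b s a else \<zero>)" if "s \<in> S" for s
      using off_diagonal[OF that] by (cases "a = s") simp_all
  qed (use closed in auto)
  also have "\<dots> = (if a \<in> S then c a \<otimes> b a a else \<zero>)"
  proof (cases "a \<in> S")
    case True
    have "(\<lambda>s. c s \<otimes> b s a) \<in> S \<rightarrow> carrier K"
      using closed by blast
    from R.finsum_singleton[OF True S(1) this] show ?thesis
      using True by simp
  next
    case False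
    then have "(\<Oplus>s\<in>S. if a = s then c s \<otimes> b s a else \<zero>) = (\<Oplus>s\<in>S. \<zero>)"
      by (intro R.finsum_cong') auto
    then show ?thesis using False by simp
  qed
  finally show ?thesis .
qed

lemma topspace_form_topology: "topspace (form_topology K V b) = carrier V"
proof -
  have "openin (form_topology K V b) (carrier V)"
    unfolding openin_form_topology basic_nhd_def by (auto intro!: exI[of _ "{}"])
  then show ?thesis
    by (auto simp: topspace_def openin_form_topology)
qed

text \<open>By linearity, continuity into the discrete field amounts to vanishing on a neighborhood
  of zero, and by symmetry one of the two variables suffices.\<close>

lemma partially_continuousI:
  assumes b': "inner_product K V b'"
    and fin: "\<And>x. x \<in> carrier V \<Longrightarrow> \<exists>S. finite S \<and> S \<subseteq> carrier V \<and>
      (\<forall>y\<in>carrier V. (\<forall>s\<in>S. b y s = \<zero>) \<longrightarrow> b' y x = \<zero>)"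
  shows "partially_continuous (form_topology K V b) (discrete_topology (carrier K)) b'"
proof -
  interpret b': inner_product K V b' by fact
  have cont: "continuous_map (form_topology K V b) (discrete_topology (carrier K)) (\<lambda>y. b' y x)"
    if x: "x \<in> carrier V" for x
    unfolding continuous_map_def topspace_form_topology topspace_discrete_topology
      openin_discrete_topology openin_form_topology
  proof (intro conjI allI impI ballI)
    fix W y assume y: "y \<in> {y \<in> carrier V. b' y x \<in> W}"
    obtain S where S: "finite S" "S \<subseteq> carrier V"
      "\<And>y. \<lbrakk>y \<in> carrier V; \<forall>s\<in>S. b y s = \<zero>\<rbrakk> \<Longrightarrow> b' y x = \<zero>"
      using fin[OF x] by blast
    have "basic_nhd K V b y S \<subseteq> {y \<in> carrier V. b' y x \<in> W}"
      using x y S(3) by (auto simp: basic_nhd_def orth_def b'.form_add b'.form_closed)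
    then show "\<exists>S. finite S \<and> S \<subseteq> carrier V \<and> basic_nhd K V b y S \<subseteq> {y \<in> carrier V. b' y x \<in> W}"
      using S by blast
  qed (use x b'.form_closed in auto)
  moreover have "continuous_map (form_topology K V b) (discrete_topology (carrier K)) (\<lambda>y. b' x y)"
    if x: "x \<in> carrier V" for x
    by (rule continuous_map_eq[OF cont[OF x]])
      (use x b'.form_sym in \<open>auto simp: topspace_form_topology\<close>)
  ultimately show ?thesis
    by (simp add: partially_continuous_def topspace_form_topology)
qed

end

text \<open>The form \<open>b0\<close> recovers every coordinate with respect to \<open>A\<close>. Only finitely many
  coordinates of \<open>x\<close> are nonzero, and since \<open>A\<close> is orthogonal for \<open>b\<close>, the value \<open>b y x\<close> involves
  only the coordinates of \<open>y\<close> at these finitely many places. So the vanishing of the corresponding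
  values of \<open>b0\<close> forces \<open>b y x = 0\<close>.\<close>

lemma nondegenerate_family_if_orthogonal:
  fixes K :: "('a, 'm) ring_scheme" and V :: "('a, 'v, 'n) module_scheme"
  assumes forms: "\<And>b. b \<in> \<F> \<Longrightarrow> inner_product K V b"
    and A: "A \<subseteq> carrier V" "module.span K V A = carrier V"
    and orth: "\<And>b v w. \<lbrakk>b \<in> \<F>; v \<in> A; w \<in> A; v \<noteq> w\<rbrakk> \<Longrightarrow> b v w = \<zero>\<^bsub>K\<^esub>"
    and b0: "b0 \<in> \<F>" "\<And>v. v \<in> A \<Longrightarrow> b0 v v \<noteq> \<zero>\<^bsub>K\<^esub>"
  shows "nondegenerate_family K V \<F>"
proof -
  interpret b0: inner_product K V b0 using b0(1) by (rule forms)
  have coords: "\<exists>S c. finite S \<and> S \<subseteq> A \<and> c \<in> S \<rightarrow> carrier K \<and> x = b0.lincomb c S"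
    if "x \<in> carrier V" for x
  proof -
    have "x \<in> b0.span A" using that by (simp only: A(2))
    then show ?thesis unfolding b0.span_def by blast
  qed
  have coord_zero: "c a = \<zero>\<^bsub>K\<^esub>"
    if "finite S" "S \<subseteq> A" "c \<in> S \<rightarrow> carrier K" "a \<in> S" "b0 (b0.lincomb c S) a = \<zero>\<^bsub>K\<^esub>" for S c a
  proof -
    have "c a \<otimes>\<^bsub>K\<^esub> b0 a a = \<zero>\<^bsub>K\<^esub>"
      using b0.form_lincomb_orthogonal[OF orth[OF b0(1)] A(1) that(1-3), of a] that(2,4,5)
      by (simp add: subset_iff)
    moreover have "c a \<in> carrier K" "b0 a a \<in> carrier K" "b0 a a \<noteq> \<zero>\<^bsub>K\<^esub>"
      using that(2-4) A(1) b0 by (blast intro: b0.form_closed)+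
    ultimately show ?thesis
      using b0.integral by blast
  qed
  have "x = \<zero>\<^bsub>V\<^esub>" if x: "x \<in> radical K V b0" for x
  proof -
    have xV: "x \<in> carrier V" and x0: "\<And>y. y \<in> carrier V \<Longrightarrow> b0 x y = \<zero>\<^bsub>K\<^esub>"
      using x by (simp_all add: radical_def)
    obtain S c where S: "finite S" "S \<subseteq> A" "c \<in> S \<rightarrow> carrier K" "x = b0.lincomb c S"
      using coords[OF xV] by blast
    have c0: "c a = \<zero>\<^bsub>K\<^esub>" if "a \<in> S" for a
    proof (rule coord_zero[OF S(1-3) that])
      show "b0 (b0.lincomb c S) a = \<zero>\<^bsub>K\<^esub>"
        unfolding S(4)[symmetric] by (rule x0) (use S(2) A(1) that in blast)
    qed
    have "b0.lincomb c S = (\<Oplus>\<^bsub>V\<^esub>a\<in>S. \<zero>\<^bsub>V\<^esub>)"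
      unfolding b0.lincomb_def
      by (rule b0.M.finsum_cong') (use c0 S(2) A(1) in \<open>auto simp: subset_iff\<close>)
    then show ?thesis using S by simp
  qed
  then have radical: "radical K V b0 = {\<zero>\<^bsub>V\<^esub>}"
    using b0.form_zero by (auto simp: radical_def)
  have "partially_continuous (form_topology K V b0) (discrete_topology (carrier K)) b"
    if b: "b \<in> \<F>" for b
  proof -
    interpret b: inner_product K V b using b by (rule forms)
    have "\<exists>S. finite S \<and> S \<subseteq> carrier V \<and>
      (\<forall>y\<in>carrier V. (\<forall>s\<in>S. b0 y s = \<zero>\<^bsub>K\<^esub>) \<longrightarrow> b y x = \<zero>\<^bsub>K\<^esub>)" if x: "x \<in> carrier V" for x
    proof -
      obtain S c where S: "finite S" "S \<subseteq> A" "c \<in> S \<rightarrow> carrier K" "x = b0.lincomb c S"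
        using coords[OF x] by blast
      have "b y x = \<zero>\<^bsub>K\<^esub>" if y: "y \<in> carrier V" "\<forall>s\<in>S. b0 y s = \<zero>\<^bsub>K\<^esub>" for y
      proof -
        obtain T d where T: "finite T" "T \<subseteq> A" "d \<in> T \<rightarrow> carrier K" "y = b0.lincomb d T"
          using coords[OF y(1)] by blast
        have bys: "b s y = \<zero>\<^bsub>K\<^esub>" if "s \<in> S" for s
        proof -
          have s: "s \<in> A" "s \<in> carrier V" using that S A by auto
          have "b y s = (if s \<in> T then d s \<otimes>\<^bsub>K\<^esub> b s s else \<zero>\<^bsub>K\<^esub>)"
            unfolding T(4) by (rule b.form_lincomb_orthogonal[OF orth[OF b] A(1) T(1-3) s(1)])
          also have "\<dots> = \<zero>\<^bsub>K\<^esub>"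
            using coord_zero[OF T(1-3), of s] y(2) that s(2) unfolding T(4)
            by (simp add: b.form_closed)
          finally show ?thesis using b.form_sym y s by simp
        qed
        have "b x y = (\<Oplus>\<^bsub>K\<^esub>s\<in>S. c s \<otimes>\<^bsub>K\<^esub> b s y)"
          unfolding S(4) by (rule b.form_lincomb) (use S(1-3) A(1) y(1) in blast)+
        also have "\<dots> = (\<Oplus>\<^bsub>K\<^esub>s\<in>S. \<zero>\<^bsub>K\<^esub>)"
          by (rule b0.R.finsum_cong') (use S(3) bys in \<open>auto simp: Pi_iff\<close>)
        finally show ?thesis using b.form_sym x y by simp
      qed
      then show ?thesis using S A by blast
    qed
    then show ?thesis by (intro b0.partially_continuousI forms b)
  qed
  with forms b0 radical show ?thesis
    unfolding nondegenerate_family_def by blast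
qed

section \<open>Ultraproducts of forms\<close>

text \<open>If \<open>B i a a = 0\<close>, then \<open>a\<close> is orthogonal to the whole basis, thus lies in the radical of
  \<open>B i\<close>. If this happened for ultrafilter-many \<open>i\<close>, then \<open>a\<close>, which is nonzero as a basis vector,
  would be pathological: a single set of the ultrafilter serves all subspaces at once.\<close>

lemma ultra_form_diagonal_nonzero:
  assumes "vectorspace K V" and forms: "\<And>i. inner_product K V (B i)"
    and nonpath: "nonpathological K V U B"
    and basis: "vectorspace.basis K V A"
    and orth: "\<And>i v w. \<lbrakk>v \<in> A; w \<in> A; v \<noteq> w\<rbrakk> \<Longrightarrow> B i v w = \<zero>\<^bsub>K\<^esub>"
    and a: "a \<in> A"
  shows "ultra_form K U B a a \<noteq> \<zero>\<^bsub>ultrapower K U\<^esub>"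
proof
  interpret vectorspace K V by fact
  have A: "A \<subseteq> carrier V" "lin_indpt A" "span A = carrier V"
    using basis by (simp_all add: basis_def)
  have aV: "a \<in> carrier V" using a A by blast
  have "\<zero>\<^bsub>V\<^esub> \<notin> A"
    using A(1,2) by (rule vs_zero_lin_dep)
  then have "a \<noteq> \<zero>\<^bsub>V\<^esub>" using a by blast
  assume "ultra_form K U B a a = \<zero>\<^bsub>ultrapower K U\<^esub>"
  then have "\<forall>\<^sub>F i in U. B i a a = \<zero>\<^bsub>K\<^esub>"
    using inner_product.form_closed[OF forms aV aV]
    unfolding ultra_form_def ultrapower_zero by (subst (asm) ultra_class_eq_iff) auto
  then have ev: "\<forall>\<^sub>F i in U. \<forall>s\<in>carrier V. B i a s = \<zero>\<^bsub>K\<^esub>"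
  proof eventually_elim
    case (elim i)
    interpret B: inner_product K V "B i" by (rule forms)
    show ?case
    proof
      fix s assume s: "s \<in> carrier V"
      then have "s \<in> span A" by (simp only: A(3))
      then obtain S c where S: "finite S" "S \<subseteq> A" "c \<in> S \<rightarrow> carrier K" "s = lincomb c S"
        unfolding span_def by blast
      have "B i s a = (if a \<in> S then c a \<otimes>\<^bsub>K\<^esub> B i a a else \<zero>\<^bsub>K\<^esub>)"
        unfolding S(4) by (rule B.form_lincomb_orthogonal[OF orth A(1) S(1-3) a])
      then show "B i a s = \<zero>\<^bsub>K\<^esub>"
        using elim S(3) B.form_sym[OF aV s] by (auto simp: Pi_iff)
    qed
  qed
  have "pathological K V U B a"
    unfolding pathological_def
  proof (intro conjI allI impI aV)
    fix S assume "subspace K S V \<and> vectorspace.fin_dim K (V\<lparr>carrier := S\<rparr>)"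
    then have S: "S \<subseteq> carrier V"
      by (auto dest: is_module submodule.subset)
    show "\<forall>\<^sub>F i in U. \<forall>s\<in>S. B i a s = \<zero>\<^bsub>K\<^esub>"
      using ev by (rule eventually_mono) (use S in blast)
  qed
  then show False
    using nonpath \<open>a \<noteq> \<zero>\<^bsub>V\<^esub>\<close> unfolding nonpathological_def by blast
qed

theorem corollary7:
  fixes K :: "('a, 'm) ring_scheme"
    and V :: "('a, 'v, 'n) module_scheme"
    and B :: "'i \<Rightarrow> 'v \<Rightarrow> 'v \<Rightarrow> 'a"
    and le :: "'i \<Rightarrow> 'i \<Rightarrow> bool"
    and U :: "'i filter"
  assumes "vectorspace K V"
    and "reflp le" and "transp le" and "\<And>i j. \<exists>k. le i k \<and> le j k"
    and "ultrafilter U" and "\<And>i. \<forall>\<^sub>F j in U. le i j"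
    and "\<And>i. inner_product K V (B i)"
    and "nonpathological K V U B"
    and "simultaneously_orthogonalizable K V B"
  shows "nondegenerate_family (ultrapower K U) (ultra_space K V U)
    (range (\<lambda>i. base_change_form K V U (B i)) \<union> {ultra_form_extension K V U B})"
proof -
  interpret vectorspace K V by fact
  let ?F = "ultrapower K U" and ?h = "ultra_const K U"
  interpret F: field ?F
    using \<open>ultrafilter U\<close> by (rule ultrapower_field)
  interpret base_change K V ?F ?h
    by unfold_locales (rule ultra_const_hom)
  let ?t = "\<lambda>a. tensor K V ?F ?h a \<one>\<^bsub>?F\<^esub>"
  obtain A where A: "basis A"
    and orth: "\<And>i v w. \<lbrakk>v \<in> A; w \<in> A; v \<noteq> w\<rbrakk> \<Longrightarrow> B i v w = \<zero>\<^bsub>K\<^esub>"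
    using \<open>simultaneously_orthogonalizable K V B\<close>
    unfolding simultaneously_orthogonalizable_def by blast
  have A': "A \<subseteq> carrier V" "span A = carrier V"
    using A by (simp_all add: basis_def)
  have ultra_form_closed: "ultra_form K U C v w \<in> carrier ?F"
    if "\<And>i. inner_product K V (C i)" "v \<in> carrier V" "w \<in> carrier V"
    for C :: "'i \<Rightarrow> 'v \<Rightarrow> 'v \<Rightarrow> 'a" and v w
    unfolding ultra_form_def
    by (intro ultra_class_closed Pi_I inner_product.form_closed[OF that(1)] that(2,3))
  \<comment> \<open>The base change of a form is the ultraproduct of a constant family, so all members of the
    family are covered by one statement about ultraproducts.\<close>
  have ext: "inner_product ?F E (ultra_form_extension K V U C) \<and>
    (\<forall>v\<in>carrier V. \<forall>w\<in>carrier V. \<forall>r\<in>carrier ?F. \<forall>s\<in>carrier ?F.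
      ultra_form_extension K V U C (tens v r) (tens w s)
      = r \<otimes>\<^bsub>?F\<^esub> s \<otimes>\<^bsub>?F\<^esub> ultra_form K U C v w)"
    if C: "\<And>i. inner_product K V (C i)" for C :: "'i \<Rightarrow> 'v \<Rightarrow> 'v \<Rightarrow> 'a"
    unfolding ultra_form_extension_def
  proof (rule form_extension_spec)
    note C' = inner_product.form_closed[OF C] inner_product.form_add[OF C]
      inner_product.form_smult[OF C]
    show "ultra_form K U C v w = ultra_form K U C w v" if "v \<in> carrier V" "w \<in> carrier V" for v w
      using that inner_product.form_sym[OF C] by (simp add: ultra_form_def)
    show "ultra_form K U C (v \<oplus>\<^bsub>V\<^esub> w) u = ultra_form K U C v u \<oplus>\<^bsub>?F\<^esub> ultra_form K U C w u"
      if "v \<in> carrier V" "w \<in> carrier V" "u \<in> carrier V" for v w u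
      using that by (simp add: ultra_form_def C' ultrapower_add Pi_iff)
    show "ultra_form K U C (c \<odot>\<^bsub>V\<^esub> v) w = ?h c \<otimes>\<^bsub>?F\<^esub> ultra_form K U C v w"
      if "c \<in> carrier K" "v \<in> carrier V" "w \<in> carrier V" for c v w
      using that by (simp add: ultra_form_def ultra_const_def C' ultrapower_mult Pi_iff)
  qed (fact F.field_axioms ultra_form_closed[OF C])+
  have base_change_eq: "base_change_form K V U b = ultra_form_extension K V U (\<lambda>i. b)" for b
    by (simp add: base_change_form_def ultra_form_extension_def ultra_form_def[abs_def] ultra_const_def)
  have on_A: "ultra_form_extension K V U C (?t v) (?t w) = ultra_form K U C v w"
    if "\<And>i. inner_product K V (C i)" "v \<in> A" "w \<in> A" for C :: "'i \<Rightarrow> 'v \<Rightarrow> 'v \<Rightarrow> 'a" and v w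
  proof -
    have vw: "v \<in> carrier V" "w \<in> carrier V" using that A' by auto
    then show ?thesis
      using ext[OF that(1)] ultra_form_closed[OF that(1) vw] by simp
  qed
  define \<C> where "\<C> = insert B (range (\<lambda>i _. B i))"
  have \<C>: "inner_product K V (C i)" "\<lbrakk>v \<in> A; w \<in> A; v \<noteq> w\<rbrakk> \<Longrightarrow> C i v w = \<zero>\<^bsub>K\<^esub>"
    if "C \<in> \<C>" for C i v w
    using that assms(7) orth by (auto simp: \<C>_def)
  have "nondegenerate_family ?F E (ultra_form_extension K V U ` \<C>)"
  proof (rule nondegenerate_family_if_orthogonal[where A = "?t ` A"
        and ?b0.0 = "ultra_form_extension K V U B"])
    show "LinearCombinations.module.span ?F E (?t ` A) = carrier E"
      using A' by (rule span_tensor_one)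
    show "?t ` A \<subseteq> carrier E"
      using A'(1) by (auto intro!: tensor_closed)
    show "ultra_form_extension K V U B \<in> ultra_form_extension K V U ` \<C>"
      by (simp add: \<C>_def)
  next
    fix b assume "b \<in> ultra_form_extension K V U ` \<C>"
    then obtain C where C: "b = ultra_form_extension K V U C" "C \<in> \<C>"
      by blast
    have form: "inner_product K V (C i)" for i
      using C(2) by (rule \<C>)
    show "inner_product ?F E b"
      unfolding C(1) using ext[of C, OF form] by blast
    fix x y assume "x \<in> ?t ` A" "y \<in> ?t ` A" "x \<noteq> y"
    then obtain v w where vw: "x = ?t v" "y = ?t w" "v \<in> A" "w \<in> A" "v \<noteq> w"
      by blast
    show "b x y = \<zero>\<^bsub>?F\<^esub>"
      unfolding C(1) vw(1,2) on_A[of C, OF form vw(3,4)]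
      by (simp add: ultra_form_def ultrapower_zero \<C>(2)[OF C(2) vw(3-5)])
  next
    fix x assume "x \<in> ?t ` A"
    then obtain v where v: "v \<in> A" "x = ?t v" by blast
    show "ultra_form_extension K V U B x x \<noteq> \<zero>\<^bsub>?F\<^esub>"
      unfolding v(2) on_A[of B, OF assms(7) v(1) v(1)]
      by (rule ultra_form_diagonal_nonzero) (fact assms A orth v(1))+
  qed
  then show ?thesis
    by (simp add: base_change_eq ultra_space_def \<C>_def image_image)
qed

end
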